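(* Assume $K_C>0$. If there is any $S\subseteq C$ with $\Delta(S)>0$ and $\mathrm{viol}(S)>0$, then the separation problem $$\max_{S\subseteq C}\Bigl\{\sum_{(i,j)\in S}(\hat f_{ij}-w_{ij}\hat x_{ij})+\Delta(S)K_C\ :\ \Delta(S)>0\Bigr\}$$ is solved by $S=S_C^*$ (i.e., $S_C^*$ is feasible and optimal for it), where $$S_C^*=\{(i,j)\in C:\ \hat f_{ij}-w_{ij}\hat x_{ij}+2w_{ij}K_C>0\}.$$
   Context: $C$ is (the finite arc set of) a directed cycle in a power network; susceptances are normalized to $B_{ij}=1$ for $(i,j)\in C$ (by scaling the capacities), so $w_{ij}=\bar f_{ij}>0$, where $\bar f_{ij}$ is the line capacity. For $S\subseteq C$, $w(S)=\sum_{(i,j)\in S}w_{ij}$ and $\Delta(S)=w(S)-w(C\setminus S)=2w(S)-w(C)$. The given point $(\hat f,\hat x)\in\mathbb{R}^C\times\mathbb{R}^C$ is a solution of a linear programming relaxation, so it satisfies $-w_{ij}\hat x_{ij}\le\hat f_{ij}\le w_{ij}\hat x_{ij}$ and $0\le\hat x_{ij}\le1$ for all $(i,j)\in C$. Define $K_C=1-\sum_{(i,j)\in C}(1-\hat x_{ij})$ and $\mathrm{viol}(S)=\sum_{(i,j)\in S}(\hat f_{ij}-w_{ij}\hat x_{ij})+\Delta(S)K_C$ for $S\subseteq C$. *)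

theory Defs
  imports Complex_Main "Graph_Theory.Pair_Digraph"
begin

text \<open>
  A vector in \<open>\<real>\<^sup>C\<close> is a function on arcs \<open>(i, j)\<close>; only its values on \<open>C\<close> matter.  The
  susceptances are normalised to 1, so the weight \<open>w\<close> of an arc is its line capacity.
\<close>

definition directed_cycle :: "'v pair_pre_digraph \<Rightarrow> ('v \<times> 'v) set \<Rightarrow> bool" where
  "directed_cycle G C \<longleftrightarrow> (\<exists>p. pre_digraph.cycle (with_proj G) p \<and> C = set p)"

definition weight :: "('v \<times> 'v \<Rightarrow> real) \<Rightarrow> ('v \<times> 'v) set \<Rightarrow> real" where
  "weight w S = (\<Sum>a\<in>S. w a)"

definition Delta :: "('v \<times> 'v) set \<Rightarrow> ('v \<times> 'v \<Rightarrow> real) \<Rightarrow> ('v \<times> 'v) set \<Rightarrow> real" where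
  "Delta C w S = weight w S - weight w (C - S)"

definition K :: "('v \<times> 'v) set \<Rightarrow> ('v \<times> 'v \<Rightarrow> real) \<Rightarrow> real" where
  "K C x = 1 - (\<Sum>a\<in>C. 1 - x a)"

text \<open>For \<open>S \<subseteq> C\<close>, this is also the objective function of the separation problem.\<close>

definition viol ::
  "('v \<times> 'v) set \<Rightarrow> ('v \<times> 'v \<Rightarrow> real) \<Rightarrow> ('v \<times> 'v \<Rightarrow> real) \<Rightarrow> ('v \<times> 'v \<Rightarrow> real)
    \<Rightarrow> ('v \<times> 'v) set \<Rightarrow> real" where
  "viol C w f x S = (\<Sum>a\<in>S. f a - w a * x a) + Delta C w S * K C x"

definition S_star ::
  "('v \<times> 'v) set \<Rightarrow> ('v \<times> 'v \<Rightarrow> real) \<Rightarrow> ('v \<times> 'v \<Rightarrow> real) \<Rightarrow> ('v \<times> 'v \<Rightarrow> real)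
    \<Rightarrow> ('v \<times> 'v) set" where
  "S_star C w f x = {a \<in> C. f a - w a * x a + 2 * w a * K C x > 0}"

end

theory Submission
  imports Defs
begin

text \<open>
  Because \<open>\<Delta>(S) = 2w(S) - w(C)\<close>, the violation is, up to the constant \<open>- w(C) K\<^sub>C\<close>, additive over
  the arcs of \<open>S\<close>: the arc \<open>a\<close> contributes \<open>f\<^sub>a - w\<^sub>a x\<^sub>a + 2 w\<^sub>a K\<^sub>C\<close> (\<open>viol_additive\<close>).  Collecting
  exactly the arcs with positive contribution therefore maximises the violation over all subsets
  of \<open>C\<close>, whatever the sign of \<open>\<Delta>\<close> (\<open>viol_le_viol_S_star\<close>).

  What remains is feasibility, \<open>\<Delta>(S\<^sup>*\<^sub>C) > 0\<close>.  The capacity bound \<open>f\<^sub>a \<le> w\<^sub>a x\<^sub>a\<close> makes the flow part of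
  the violation nonpositive, so a set with positive violation has \<open>\<Delta>(S) K\<^sub>C > 0\<close>, and \<open>K\<^sub>C > 0\<close>
  gives \<open>\<Delta>(S) > 0\<close> (\<open>Delta_pos_if_viol_pos\<close>).  The maximiser inherits positive violation from the
  set that is assumed to exist.
\<close>

lemma Delta_eq:
  assumes "finite C" "S \<subseteq> C"
  shows "Delta C w S = 2 * weight w S - weight w C"
  unfolding Delta_def weight_def sum_diff[OF assms] by simp

lemma viol_additive:
  assumes "finite C" "S \<subseteq> C"
  shows "viol C w f x S = (\<Sum>a\<in>S. f a - w a * x a + 2 * w a * K C x) - weight w C * K C x"
proof -
  have "(\<Sum>a\<in>S. 2 * w a * K C x) = 2 * weight w S * K C x"
    unfolding weight_def sum_distrib_left sum_distrib_right ..
  then show ?thesis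
    unfolding viol_def Delta_eq[OF assms] sum.distrib left_diff_distrib by linarith
qed

lemma sum_le_sum_pos_part:
  fixes g :: "'a \<Rightarrow> 'b :: linordered_ab_group_add"
  assumes "finite C" "S \<subseteq> C"
  shows "sum g S \<le> sum g {a \<in> C. 0 < g a}"
proof -
  have "finite S"
    using assms by (rule rev_finite_subset)
  have "sum g S \<le> (\<Sum>a\<in>S. if 0 < g a then g a else 0)"
    by (rule sum_mono) auto
  also have "\<dots> = sum g {a \<in> S. 0 < g a}"
    using \<open>finite S\<close> by (simp add: sum.inter_filter)
  also have "\<dots> \<le> sum g {a \<in> C. 0 < g a}"
    using assms by (intro sum_mono2) auto
  finally show ?thesis .
qed

lemma viol_le_viol_S_star:
  assumes "finite C" "S \<subseteq> C"
  shows "viol C w f x S \<le> viol C w f x (S_star C w f x)"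
proof -
  have "S_star C w f x \<subseteq> C"
    by (auto simp: S_star_def)
  show ?thesis
    using sum_le_sum_pos_part[OF assms, of "\<lambda>a. f a - w a * x a + 2 * w a * K C x"]
    unfolding viol_additive[OF assms] viol_additive[OF assms(1) \<open>S_star C w f x \<subseteq> C\<close>]
    by (simp only: S_star_def diff_right_mono)
qed

lemma Delta_pos_if_viol_pos:
  assumes "\<And>a. a \<in> S \<Longrightarrow> f a \<le> w a * x a" "0 < K C x" "0 < viol C w f x S"
  shows "0 < Delta C w S"
proof -
  have "(\<Sum>a\<in>S. f a - w a * x a) \<le> 0"
    using assms(1) by (intro sum_nonpos) simp
  then have "0 < Delta C w S * K C x"
    using assms(3) by (simp add: viol_def)
  then show ?thesis
    using assms(2) by (rule zero_less_mult_pos2)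
qed

theorem proposition4p4:
  fixes G :: "'v pair_pre_digraph"
    and C :: "('v \<times> 'v) set"
    and w f x :: "'v \<times> 'v \<Rightarrow> real"
  assumes "pair_fin_digraph G"
    and "directed_cycle G C"
    and "\<And>a. a \<in> C \<Longrightarrow> 0 < w a"
    and "\<And>a. a \<in> C \<Longrightarrow> - w a * x a \<le> f a \<and> f a \<le> w a * x a"
    and "\<And>a. a \<in> C \<Longrightarrow> 0 \<le> x a \<and> x a \<le> 1"
    and "K C x > 0"
    and "\<exists>S \<subseteq> C. Delta C w S > 0 \<and> viol C w f x S > 0"
  shows "is_arg_max (viol C w f x) (\<lambda>S. S \<subseteq> C \<and> Delta C w S > 0) (S_star C w f x)"
proof -
  have fin: "finite C"
    using assms(2) by (auto simp: directed_cycle_def)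
  have sub: "S_star C w f x \<subseteq> C"
    by (auto simp: S_star_def)
  obtain S where "S \<subseteq> C" "0 < viol C w f x S"
    using assms(7) by blast
  then have "0 < viol C w f x (S_star C w f x)"
    using viol_le_viol_S_star[OF fin, of S w f x] by linarith
  then have "0 < Delta C w (S_star C w f x)"
    using Delta_pos_if_viol_pos[of "S_star C w f x" f w x C] sub assms(4,6) by blast
  then show ?thesis
    unfolding is_arg_max_def not_ex de_Morgan_conj not_less
    using sub viol_le_viol_S_star[OF fin] by blast
qed

end
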